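(* Let $\varepsilon_1,\varepsilon_2>0$, and let $W_0,W_{-1}$ be the branches $0$ and $-1$ of the Lambert $W$ function. For any three nondegenerate $n$-dimensional Gaussian distributions $\mathcal{N}_i=\mathcal{N}(\bm\mu_i,\bm\Sigma_i)$, $i=1,2,3$ (any $n\ge1$), if $KL(\mathcal{N}_1\|\mathcal{N}_2)\le\varepsilon_1$ and $KL(\mathcal{N}_2\|\mathcal{N}_3)\le\varepsilon_2$, then, writing $a=W_{-1}(-e^{-(1+2\varepsilon_1)})$, $b=W_{-1}(-e^{-(1+2\varepsilon_2)})$ and $c=W_0(-e^{-(1+2\varepsilon_2)})$, $$KL(\mathcal{N}_1\|\mathcal{N}_3)<\varepsilon_1+\varepsilon_2+\frac12\left\{ab+a+b+1-b\left(\sqrt{2\varepsilon_1}+\sqrt{\frac{2\varepsilon_2}{-c}}\right)^2\right\}.$$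
   Context: $KL(p\|q)=\int p\log(p/q)$ is the Kullback–Leibler divergence. The Lambert $W$ function is the (multivalued) inverse of $y=xe^x$; on real arguments in $[-1/e,0)$ it has two real branches: the principal branch $W_0$ (values in $[-1,0)$) and the branch $W_{-1}$ (values in $(-\infty,-1]$). *)

theory Defs
  imports "HOL-Analysis.Analysis"
begin

text \<open>Real branches of the Lambert W function on [-1/e, 0).
  Principal branch W0: the unique w \<ge> -1 with w * exp w = y.
  Branch W_{-1}: the unique w \<le> -1 with w * exp w = y.\<close>
definition lambertW0 :: "real \<Rightarrow> real" where
  "lambertW0 y = (THE w. -1 \<le> w \<and> w * exp w = y)"

definition lambertWm1 :: "real \<Rightarrow> real" where
  "lambertWm1 y = (THE w. w \<le> -1 \<and> w * exp w = y)"

definition pos_def_matrix :: "real^'n^'n \<Rightarrow> bool" where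
  "pos_def_matrix S \<longleftrightarrow> transpose S = S \<and> (\<forall>v. v \<noteq> 0 \<longrightarrow> v \<bullet> (S *v v) > 0)"

definition gauss_density :: "real^'n \<Rightarrow> real^'n^'n \<Rightarrow> real^'n \<Rightarrow> real" where
  "gauss_density mu S x =
     exp (- ((x - mu) \<bullet> (matrix_inv S *v (x - mu))) / 2)
     / sqrt ((2 * pi) ^ CARD('n) * det S)"

definition KL_div :: "('a::euclidean_space \<Rightarrow> real) \<Rightarrow> ('a \<Rightarrow> real) \<Rightarrow> real" where
  "KL_div p q = (\<integral>x. p x * ln (p x / q x) \<partial>lborel)"

end

theory Submission
  imports Defs "HOL-Probability.Distributions"
begin

text \<open>
  Whitening by \<open>S2 = L L\<^sup>T\<close> replaces the three covariances by \<open>A = L\<^sup>-\<^sup>1 S1 L\<^sup>-\<^sup>T\<close> and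
  \<open>B = L\<^sup>T S3\<^sup>-\<^sup>1 L\<close>. Writing \<open>f x = x - 1 - ln x\<close>, the hypotheses bound \<open>\<Sum>f\<close> over the eigenvalues of
  \<open>A\<close> and of \<open>B\<close> together with the mean terms \<open>|m|\<^sup>2\<close> and \<open>m' \<bullet> B m'\<close>, and
  \<open>2 KL13 - 2 KL12 - 2 KL23 = tr ((A - I) (B - I)) + (m + m') \<bullet> B (m + m') - |m|\<^sup>2 - m' \<bullet> B m'\<close>.
  The trace is at most the product of the Frobenius norms. Since \<open>s \<mapsto> f (1 + sqrt s)\<close> is concave and
  vanishes at \<open>0\<close>, hence subadditive, each norm is largest when the whole divergence budget sits in
  a single eigenvalue larger than 1; the equation \<open>f x = 2 \<epsilon>\<close> for it is solved by the Lambert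
  branches, \<open>x = - W (- exp (- (1 + 2 \<epsilon>)))\<close>. The same equation confines the eigenvalues of \<open>B\<close> to
  \<open>[- c, - b]\<close>, which bounds the quadratic form.
\<close>

section \<open>The function \<open>x - 1 - ln x\<close> and the Lambert branches\<close>

text \<open>The Itakura-Saito distance between \<open>x\<close> and \<open>1\<close>; half of it is
  the divergence of the centred Gaussian of variance \<open>x\<close> from the standard one on the
  line.\<close>

definition itakura_saito :: "real \<Rightarrow> real" where
  "itakura_saito x = x - 1 - ln x"

lemma itakura_saito_1 [simp]: "itakura_saito 1 = 0"
  by (simp add: itakura_saito_def)

lemma itakura_saito_nonneg: "0 < x \<Longrightarrow> 0 \<le> itakura_saito x"
  using ln_le_minus_one[of x] by (simp add: itakura_saito_def)

lemma continuous_on_itakura_saito: "S \<subseteq> {0<..} \<Longrightarrow> continuous_on S itakura_saito"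
  unfolding itakura_saito_def by (intro continuous_intros) auto

text \<open>The strict form of \<open>ln r \<le> r - 1\<close> at \<open>r = y / x\<close>, after
  which dividing \<open>y - x\<close> by \<open>x \<ge> 1\<close> can only shrink it. The decreasing
  branch uses the inverse ratio in the same way.\<close>

lemma itakura_saito_strict_mono:
  assumes "1 \<le> x" "x < y"
  shows "itakura_saito x < itakura_saito y"
proof -
  have "ln y - ln x = ln (y / x)" using assms by (simp add: ln_div)
  also have "\<dots> < y / x - 1"
    using assms ln_eq_minus_one[of "y/x"] ln_le_minus_one[of "y/x"]
    by (force simp: less_le)
  also have "\<dots> = (y - x) / x" using assms by (simp add: field_simps)
  also have "\<dots> \<le> y - x" using assms by (simp add: divide_le_eq mult_le_cancel_left1)
  finally show ?thesis by (simp add: itakura_saito_def)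
qed

lemma itakura_saito_strict_antimono:
  assumes "0 < x" "x < y" "y \<le> 1"
  shows "itakura_saito y < itakura_saito x"
proof -
  have "ln x - ln y = ln (x / y)" using assms by (simp add: ln_div)
  also have "\<dots> < x / y - 1"
    using assms ln_eq_minus_one[of "x/y"] ln_le_minus_one[of "x/y"]
    by (force simp: less_le)
  also have "\<dots> = - ((y - x) / y)" using assms by (simp add: field_simps)
  also have "\<dots> \<le> - (y - x)"
  proof -
    have "(y - x) * y \<le> y - x" using assms by (intro mult_left_le) auto
    then have "y - x \<le> (y - x) / y" using assms by (simp only: pos_le_divide_eq)
    then show ?thesis by simp
  qed
  finally show ?thesis by (simp add: itakura_saito_def)
qed

text \<open>A negative right side forces \<open>w < 0\<close>; the logarithm of the negated equation
  is then \<open>ln (- w) + w = - (1 + t)\<close>.\<close>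

lemma mult_exp_eq_iff_itakura_saito:
  "w * exp w = - exp (- (1 + t)) \<longleftrightarrow> w < 0 \<and> itakura_saito (- w) = t"
proof -
  have "w < 0" if "w * exp w = - exp (- (1 + t))"
    using that by (smt (verit) exp_gt_zero mult_nonneg_nonneg)
  moreover have "w * exp w = - exp (- (1 + t)) \<longleftrightarrow> itakura_saito (- w) = t" if "w < 0"
  proof -
    have "w * exp w = - exp (- (1 + t)) \<longleftrightarrow> exp (ln (- w) + w) = exp (- (1 + t))"
      using that by (auto simp: exp_add)
    also have "\<dots> \<longleftrightarrow> itakura_saito (- w) = t"
      by (auto simp: itakura_saito_def)
    finally show ?thesis .
  qed
  ultimately show ?thesis by blast
qed

text \<open>Makes the definite description in \<open>lambertWm1\<close> usable: the intermediate
  value theorem gives a solution, strict monotonicity to the right of 1 its uniqueness.\<close>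

lemma lambertWm1_itakura_saito:
  assumes "0 \<le> t"
  defines "w \<equiv> lambertWm1 (- exp (- (1 + t)))"
  shows "w \<le> -1" "itakura_saito (- w) = t"
proof -
  \<comment> \<open>Since \<open>ln u = ln 2 + ln (t + 1) \<le> 1 + t\<close>, the value at
    \<open>u\<close> is at least \<open>t\<close>, so \<open>u\<close> can serve as right end of the
    interval.\<close>
  define u where "u = 2 * (t + 1)"
  have "ln (t + 1) \<le> t" "ln 2 \<le> (1::real)"
    using ln_le_minus_one[of "t+1"] ln_le_minus_one[of 2] assms by auto
  then have "t \<le> itakura_saito u"
    using assms(1) ln_mult[of 2 "t + 1"] by (simp add: u_def itakura_saito_def)
  then obtain x where x: "1 \<le> x" "itakura_saito x = t"
    using IVT'[of itakura_saito 1 t u] assms continuous_on_itakura_saito[of "{1..u}"]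
    by (force simp: u_def)
  have "w \<le> -1 \<and> w * exp w = - exp (- (1 + t))"
    unfolding w_def lambertWm1_def
  proof (rule theI[where a = "- x"])
    show "- x \<le> -1 \<and> - x * exp (- x) = - exp (- (1 + t))"
      using x mult_exp_eq_iff_itakura_saito[of "- x" t] by simp
  next
    fix v assume "v \<le> - 1 \<and> v * exp v = - exp (- (1 + t))"
    then have "1 \<le> - v" "itakura_saito (- v) = itakura_saito x"
      using x mult_exp_eq_iff_itakura_saito[of v t] by auto
    with x(1) itakura_saito_strict_mono[of "- v" x] itakura_saito_strict_mono[of x "- v"]
    show "v = - x" by force
  qed
  then show "w \<le> -1" "itakura_saito (- w) = t"
    using mult_exp_eq_iff_itakura_saito[of w t] by auto
qed

lemma lambertW0_itakura_saito:
  assumes "0 \<le> t"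
  defines "w \<equiv> lambertW0 (- exp (- (1 + t)))"
  shows "-1 \<le> w" "w < 0" "itakura_saito (- w) = t"
proof -
  \<comment> \<open>Here \<open>ln u = - (1 + t)\<close>, so the value at \<open>u\<close> is
    exactly \<open>u + t\<close>, which exceeds \<open>t\<close>.\<close>
  define u where "u = exp (- (1 + t))"
  have u: "0 < u" "u \<le> 1" using assms by (auto simp: u_def)
  then have "t \<le> itakura_saito u"
    by (simp add: u_def itakura_saito_def)
  then obtain x where x: "0 < x" "x \<le> 1" "itakura_saito x = t"
    using IVT2'[of itakura_saito 1 t u] assms(1) continuous_on_itakura_saito[of "{u..1}"] u
    by (auto simp: subset_eq intro: less_le_trans)
  have "-1 \<le> w \<and> w * exp w = - exp (- (1 + t))"
    unfolding w_def lambertW0_def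
  proof (rule theI[where a = "- x"])
    show "-1 \<le> - x \<and> - x * exp (- x) = - exp (- (1 + t))"
      using x mult_exp_eq_iff_itakura_saito[of "- x" t] by simp
  next
    fix v assume "-1 \<le> v \<and> v * exp v = - exp (- (1 + t))"
    then have "- v \<le> 1" "0 < - v" "itakura_saito (- v) = itakura_saito x"
      using x mult_exp_eq_iff_itakura_saito[of v t] by auto
    with x itakura_saito_strict_antimono[of "- v" x] itakura_saito_strict_antimono[of x "- v"]
    show "v = - x" by force
  qed
  then show "-1 \<le> w" "w < 0" "itakura_saito (- w) = t"
    using mult_exp_eq_iff_itakura_saito[of w t] by auto
qed

section \<open>Divergence as a concave function of the squared deviation from 1\<close>

definition sqrt_dev :: "real \<Rightarrow> real" where
  "sqrt_dev s = itakura_saito (1 + sqrt s)"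

text \<open>The chain rule factor \<open>1 / (2 * sqrt s)\<close> cancels the numerator of
  \<open>1 - 1 / (1 + sqrt s) = sqrt s / (1 + sqrt s)\<close>. What remains decreases in
  \<open>s\<close>, which is the concavity used for subadditivity.\<close>

lemma sqrt_dev_deriv:
  assumes "0 < s"
  shows "(sqrt_dev has_real_derivative 1 / (2 * (1 + sqrt s))) (at s)"
proof -
  have pos: "0 < sqrt s" "0 < 1 + sqrt s" "2 + 2 * sqrt s \<noteq> 0"
    using assms by (simp_all add: add_pos_pos) (smt (verit) real_sqrt_gt_zero)
  then show ?thesis
    unfolding sqrt_dev_def itakura_saito_def using assms
    by (auto intro!: derivative_eq_intros simp: divide_simps)
qed

lemma continuous_on_sqrt_dev: "S \<subseteq> {0..} \<Longrightarrow> continuous_on S sqrt_dev"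
  unfolding sqrt_dev_def itakura_saito_def
  by (intro continuous_intros) (smt (verit) real_sqrt_ge_zero subsetD atLeast_iff)

lemma sqrt_dev_add_le:
  assumes "0 \<le> s" "0 \<le> t"
  shows "sqrt_dev (s + t) \<le> sqrt_dev s + sqrt_dev t"
proof -
  let ?g = "\<lambda>x. sqrt_dev x - sqrt_dev (x + t)"
  have "?g 0 \<le> ?g s"
  \<comment> \<open>The derivative is available only at positive arguments, so monotonicity on the
    open interval is combined with continuity at the end \<open>0\<close>, where
    \<open>sqrt_dev\<close> vanishes.\<close>
  proof (rule DERIV_nonneg_imp_increasing_open[OF assms(1)])
    fix x assume x: "0 < x" "x < s"
    have "(?g has_real_derivative 1 / (2 * (1 + sqrt x)) - 1 / (2 * (1 + sqrt (x + t)))) (at x)"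
      using x assms by (intro DERIV_diff sqrt_dev_deriv DERIV_shift[THEN iffD1]) auto
    moreover have "0 \<le> 1 / (2 * (1 + sqrt x)) - 1 / (2 * (1 + sqrt (x + t)))"
    proof -
      have "0 \<le> sqrt x" "sqrt x \<le> sqrt (x + t)" using x assms by auto
      then show ?thesis
        by (intro diff_ge_0_iff_ge[THEN iffD2] frac_le) (auto intro: add_pos_nonneg)
    qed
    ultimately show "\<exists>y. (?g has_real_derivative y) (at x) \<and> 0 \<le> y" by blast
  next
    show "continuous_on {0..s} ?g"
      using assms
      by (intro continuous_on_diff continuous_on_sqrt_dev
           continuous_on_compose2[OF continuous_on_sqrt_dev[of "{0..}"]] continuous_intros) auto
  qed
  then show ?thesis by (simp add: sqrt_dev_def)
qed

lemma sqrt_dev_sum_le: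
  assumes "finite I" "\<And>i. i \<in> I \<Longrightarrow> 0 \<le> g i"
  shows "sqrt_dev (\<Sum>i\<in>I. g i) \<le> (\<Sum>i\<in>I. sqrt_dev (g i))"
  using assms
proof (induction I rule: finite_induct)
  case empty then show ?case by (simp add: sqrt_dev_def)
next
  case (insert i I)
  then show ?case
    using sqrt_dev_add_le[of "g i" "sum g I"] by (force simp: sum_nonneg)
qed

text \<open>The difference of the two sides starts at 0 and has derivative
  \<open>2 * x\<^sup>2 / ((1 - x) * (1 + x))\<close>. Deviating downwards from 1 thus costs at least
  as much as deviating upwards by the same amount, so the extremal eigenvalue lies above 1.\<close>

lemma itakura_saito_reflect_le:
  assumes "0 \<le> u" "u < 1"
  shows "itakura_saito (1 + u) \<le> itakura_saito (1 - u)"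
proof -
  let ?g = "\<lambda>x. itakura_saito (1 - x) - itakura_saito (1 + x)"
  have "?g 0 \<le> ?g u"
  proof (rule DERIV_nonneg_imp_nondecreasing[OF assms(1)])
    fix x assume x: "0 \<le> x" "x \<le> u"
    then have "x < 1" using assms by simp
    then have "(?g has_real_derivative (1 / (1 - x) + 1 / (1 + x) - 2)) (at x)"
      unfolding itakura_saito_def using x
      by (auto intro!: derivative_eq_intros)
    moreover have "1 / (1 - x) + 1 / (1 + x) - 2 = 2 * x\<^sup>2 / ((1 - x) * (1 + x))"
      using x \<open>x < 1\<close> by (simp add: divide_simps) (simp add: algebra_simps power2_eq_square)
    then have "0 \<le> 1 / (1 - x) + 1 / (1 + x) - 2"
      using x \<open>x < 1\<close> by simp
    ultimately show "\<exists>y. (?g has_real_derivative y) (at x) \<and> 0 \<le> y" by blast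
  qed
  then show ?thesis by simp
qed

lemma sqrt_dev_le_itakura_saito:
  assumes "0 < x"
  shows "sqrt_dev ((x - 1)\<^sup>2) \<le> itakura_saito x"
proof (cases "1 \<le> x")
  case True
  then show ?thesis by (simp add: sqrt_dev_def)
next
  case False
  then show ?thesis using itakura_saito_reflect_le[of "1 - x"] assms by (simp add: sqrt_dev_def)
qed

text \<open>If the squares added up to more, one value \<open>1 + sqrt ?s\<close> carrying all of
  them would lie beyond \<open>y\<close> and cost more than \<open>y\<close>; by subadditivity the
  separate values cost at least as much as that one.\<close>

lemma sum_squares_le_of_itakura_saito:
  assumes "finite I" "\<And>i. i \<in> I \<Longrightarrow> 0 < x i" "1 \<le> y"
    and "(\<Sum>i\<in>I. itakura_saito (x i)) \<le> itakura_saito y"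
  shows "(\<Sum>i\<in>I. (x i - 1)\<^sup>2) \<le> (y - 1)\<^sup>2"
proof (rule ccontr)
  let ?s = "\<Sum>i\<in>I. (x i - 1)\<^sup>2"
  assume "\<not> ?thesis"
  then have "y < 1 + sqrt ?s"
    using real_less_rsqrt[of "y - 1" ?s] by simp
  then have "itakura_saito y < sqrt_dev ?s"
    unfolding sqrt_dev_def using assms(3) by (rule itakura_saito_strict_mono[rotated])
  also have "\<dots> \<le> (\<Sum>i\<in>I. sqrt_dev ((x i - 1)\<^sup>2))"
    using assms(1) by (intro sqrt_dev_sum_le) auto
  also have "\<dots> \<le> (\<Sum>i\<in>I. itakura_saito (x i))"
    using assms(2) by (intro sum_mono sqrt_dev_le_itakura_saito) auto
  finally show False using assms(4) by simp
qed

lemma itakura_saito_le_imp_bounds: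
  assumes "0 < x" "0 < c" "c \<le> 1" "1 \<le> b"
    and "itakura_saito x \<le> itakura_saito c" "itakura_saito x \<le> itakura_saito b"
  shows "c \<le> x" "x \<le> b"
  using assms itakura_saito_strict_mono[of b x] itakura_saito_strict_antimono[of x c] by force+

section \<open>Diagonalization of symmetric matrices\<close>

lemma inner_matrix_vector_mult:
  fixes A :: "real^'n^'m"
  shows "x \<bullet> (A *v y) = (transpose A *v x) \<bullet> y"
  by (simp add: dot_lmul_matrix transpose_matrix_vector)

lemma inner_transpose_mult:
  fixes P :: "real^'n^'m" and Z :: "real^'k^'m"
  shows "x \<bullet> ((transpose P ** Z) *v y) = (P *v x) \<bullet> (Z *v y)"
  unfolding matrix_vector_mul_assoc[symmetric] inner_matrix_vector_mult[of x "transpose P"]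
    transpose_transpose ..

text \<open>A maximizer \<open>v\<close> of the Rayleigh quotient on the unit sphere of
  \<open>V\<close> is an eigenvector: the residual \<open>A *v v - c *\<^sub>R v\<close> lies in
  \<open>V\<close>, and moving \<open>v\<close> in its direction would otherwise raise the
  quotient.\<close>

lemma symmetric_matrix_eigenvector_in_subspace:
  fixes A :: "real^'n^'n"
  assumes sym: "transpose A = A" and V: "subspace V" "V \<noteq> {0}"
    and inv: "\<And>v. v \<in> V \<Longrightarrow> A *v v \<in> V"
  obtains v c where "v \<in> V" "norm v = 1" "A *v v = c *\<^sub>R v"
proof -
  let ?q = "\<lambda>x. x \<bullet> (A *v x)"
  let ?K = "sphere 0 1 \<inter> V"
  have "compact ?K" by (intro compact_Int_closed closed_subspace V) simp
  moreover obtain u where "u \<in> V" "u \<noteq> 0" using V subspace_0 by blast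
  then have "u /\<^sub>R norm u \<in> ?K" using V by (simp add: subspace_scale)
  then have "?K \<noteq> {}" by blast
  moreover have "continuous_on ?K ?q" by (intro continuous_intros)
  ultimately obtain v where v: "v \<in> ?K" and max: "\<And>x. x \<in> ?K \<Longrightarrow> ?q x \<le> ?q v"
    using continuous_attains_sup[of ?K ?q] by blast
  define c where "c = ?q v"
  have le: "?q x \<le> c * (x \<bullet> x)" if "x \<in> V" for x
  proof (cases "x = 0")
    case False
    then have "x /\<^sub>R norm x \<in> ?K" using V that by (simp add: subspace_scale)
    then have "?q (x /\<^sub>R norm x) \<le> c" unfolding c_def by (rule max)
    then have "?q x / (norm x)\<^sup>2 \<le> c"
      by (simp add: matrix_vector_mult_scaleR divide_inverse power2_eq_square algebra_simps)
    then show ?thesis using False by (simp add: divide_le_eq power2_norm_eq_inner)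
  qed simp
  have nv: "v \<bullet> v = 1" and vV: "v \<in> V" using v by (auto simp: norm_eq_1)
  define w where "w = A *v v - c *\<^sub>R v"
  have wV: "w \<in> V" unfolding w_def by (intro subspace_diff subspace_scale V inv vV)
  have wv: "w \<bullet> v = 0" by (simp add: w_def c_def inner_diff_left nv inner_commute[of "A *v v"])
  have wAv: "w \<bullet> (A *v v) = w \<bullet> w"
    using wv by (simp add: w_def inner_diff_right)
  have vAw: "v \<bullet> (A *v w) = w \<bullet> w"
    using wAv inner_matrix_vector_mult[of v A w] by (simp add: sym inner_commute)
  define k where "k = c * (w \<bullet> w) - ?q w"
  \<comment> \<open>Maximality tested at \<open>v + t *\<^sub>R w\<close>: the first-order gain in
    \<open>t\<close> is dominated by a second-order term.\<close>
  have key: "2 * t * (w \<bullet> w) \<le> t\<^sup>2 * k" for t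
  proof -
    have "v + t *\<^sub>R w \<in> V" by (intro subspace_add subspace_scale V vV wV)
    from le[OF this] show ?thesis
      by (simp add: matrix_vector_right_distrib matrix_vector_mult_scaleR inner_add_left inner_add_right
         wAv vAw wv nv inner_commute[of v w] c_def[symmetric] k_def power2_eq_square algebra_simps)
  qed
  have "w \<bullet> w \<le> 0"
  proof (rule ccontr)
    assume pos: "\<not> w \<bullet> w \<le> 0"
    \<comment> \<open>Small enough that \<open>t * k \<le> w \<bullet> w\<close>, against
      \<open>2 * (w \<bullet> w) \<le> t * k\<close>; the \<open>+ 1\<close> keeps the denominator
      positive.\<close>
    define t where "t = (w \<bullet> w) / (\<bar>k\<bar> + 1)"
    have t: "0 < t" unfolding t_def using pos by (intro divide_pos_pos) auto
    have "t * (2 * (w \<bullet> w)) \<le> t * (t * k)" using key[of t] by (simp add: power2_eq_square algebra_simps)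
    then have "2 * (w \<bullet> w) \<le> t * k" using t by simp
    also have "\<dots> \<le> t * (\<bar>k\<bar> + 1)" using t by (intro mult_left_mono) auto
    also have "\<dots> = w \<bullet> w" by (simp add: t_def)
    finally show False using pos by simp
  qed
  then have "w = 0" using inner_gt_zero_iff[of w] by linarith
  then have "A *v v = c *\<^sub>R v" by (simp add: w_def)
  then show thesis using that vV v by auto
qed

text \<open>Induction on the number of eigenvectors. By symmetry the orthogonal complement of those
  already found is invariant under \<open>A\<close>, and it is nonzero while fewer than
  \<open>CARD('n)\<close> are present, so it contains a further one.\<close>

lemma symmetric_matrix_orthonormal_eigenvectors:
  fixes A :: "real^'n^'n"
  assumes sym: "transpose A = A" and "k \<le> CARD('n)"
  shows "\<exists>B. finite B \<and> card B = k \<and> pairwise orthogonal B \<and>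
           (\<forall>b\<in>B. norm b = 1 \<and> (\<exists>c. A *v b = c *\<^sub>R b))"
  using assms(2)
proof (induction k)
  case 0
  then show ?case by (intro exI[of _ "{}"]) auto
next
  case (Suc k)
  then obtain B where B: "finite B" "card B = k" "pairwise orthogonal B"
    and eig: "\<And>b. b \<in> B \<Longrightarrow> norm b = 1 \<and> (\<exists>c. A *v b = c *\<^sub>R b)"
    by auto
  let ?V = "{v. \<forall>b\<in>B. orthogonal b v}"
  have sub: "subspace ?V" by (simp add: subspace_def orthogonal_def inner_add_right)
  have "dim B < DIM(real^'n)" using dim_le_card'[OF B(1)] B(2) Suc.prems by simp
  then obtain x where "x \<noteq> 0" "\<And>y. y \<in> span B \<Longrightarrow> orthogonal x y"
    using orthogonal_to_subspace_exists[of B] by blast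
  then have "?V \<noteq> {0}" by (auto simp: orthogonal_commute span_base)
  moreover have "A *v v \<in> ?V" if v: "v \<in> ?V" for v
  proof clarify
    fix b assume b: "b \<in> B"
    then obtain c where "A *v b = c *\<^sub>R b" using eig by blast
    then have "b \<bullet> (A *v v) = c * (b \<bullet> v)" using inner_matrix_vector_mult[of b A v] sym by simp
    then show "orthogonal b (A *v v)" using v b by (simp add: orthogonal_def)
  qed
  ultimately obtain v c where v: "v \<in> ?V" "norm v = 1" "A *v v = c *\<^sub>R v"
    by (rule symmetric_matrix_eigenvector_in_subspace[OF sym sub])
  have "v \<notin> B" using v by (auto simp: orthogonal_def)
  with v B eig show ?case
    by (intro exI[of _ "insert v B"]) (auto simp: pairwise_insert orthogonal_commute)
qed

section \<open>Diagonal matrices and the spectral theorem\<close>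

definition diag_matrix :: "('n \<Rightarrow> real) \<Rightarrow> real^'n^'n" where
  "diag_matrix d = (\<chi> i j. if i = j then d i else 0)"

lemma diag_matrix_vector_mult: "diag_matrix d *v x = (\<chi> i. d i * x $ i)"
  by (simp add: diag_matrix_def matrix_vector_mult_def vec_eq_iff if_distrib[of "\<lambda>a. a * _"] cong: if_cong)

lemma diag_matrix_mult: "diag_matrix d ** diag_matrix e = diag_matrix (\<lambda>i. d i * e i)"
  by (simp add: diag_matrix_def matrix_matrix_mult_def vec_eq_iff if_distrib[of "\<lambda>a. a * _"] cong: if_cong)

lemma diag_matrix_diff: "diag_matrix d - diag_matrix e = diag_matrix (\<lambda>i. d i - e i)"
  by (simp add: diag_matrix_def vec_eq_iff)

lemma diag_matrix_1: "diag_matrix (\<lambda>_. 1) = mat 1"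
  by (simp add: diag_matrix_def mat_def)

lemma transpose_diag_matrix [simp]: "transpose (diag_matrix d) = diag_matrix d"
  by (simp add: diag_matrix_def transpose_def vec_eq_iff)

lemma det_diag_matrix: "det (diag_matrix d) = (\<Prod>i\<in>UNIV. d i)"
  by (subst det_diagonal) (auto simp: diag_matrix_def)

lemma trace_diag_matrix: "trace (diag_matrix d) = (\<Sum>i\<in>UNIV. d i)"
  by (simp add: trace_def diag_matrix_def)

theorem symmetric_matrix_diagonalization:
  fixes A :: "real^'n^'n"
  assumes sym: "transpose A = A"
  obtains Q d where "orthogonal_matrix Q" "A = Q ** diag_matrix d ** transpose Q"
proof -
  obtain B where B: "finite B" "card B = CARD('n)" "pairwise orthogonal B"
    and eig: "\<And>b. b \<in> B \<Longrightarrow> norm b = 1 \<and> (\<exists>c. A *v b = c *\<^sub>R b)"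
    using symmetric_matrix_orthonormal_eigenvectors[OF sym order_refl] by blast
  then obtain f where f: "bij_betw f (UNIV :: 'n set) B"
    using finite_same_card_bij[of "UNIV :: 'n set" B] by auto
  then have "\<forall>i. \<exists>c. A *v f i = c *\<^sub>R f i" using eig bij_betwE by blast
  then obtain d where d: "\<And>i. A *v f i = d i *\<^sub>R f i" by metis
  let ?Q = "(\<chi> i j. f j $ i) :: real^'n^'n"
  have Q: "orthogonal_matrix ?Q"
    unfolding orthogonal_matrix_orthonormal_columns
    using f eig B(3) by (simp add: column_def pairwise_def bij_betw_def inj_on_def) blast
  have "A ** ?Q = ?Q ** diag_matrix d"
  proof -
    have "(A ** ?Q) $ i $ j = (A *v f j) $ i" for i j
      by (simp add: matrix_matrix_mult_def matrix_vector_mult_def)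
    moreover have "(?Q ** diag_matrix d) $ i $ j = d j * f j $ i" for i j
      by (simp add: matrix_matrix_mult_def diag_matrix_def mult.commute if_distrib[of "\<lambda>a. _ * a"] cong: if_cong)
    ultimately show ?thesis by (simp add: vec_eq_iff d)
  qed
  then have "A = ?Q ** diag_matrix d ** transpose ?Q"
    using Q by (metis matrix_mul_assoc matrix_mul_rid orthogonal_matrix_def)
  with Q show thesis using that by blast
qed

text \<open>The diagonal entry \<open>d i\<close> is the value of the quadratic form of
  \<open>A\<close> at the \<open>i\<close>-th column of \<open>Q\<close>.\<close>

lemma pos_def_matrix_diagonalization:
  fixes A :: "real^'n^'n"
  assumes "pos_def_matrix A"
  obtains Q d where "orthogonal_matrix Q" "A = Q ** diag_matrix d ** transpose Q" "\<And>i. 0 < d i"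
proof -
  obtain Q d where Q: "orthogonal_matrix Q" and A: "A = Q ** diag_matrix d ** transpose Q"
    using assms symmetric_matrix_diagonalization unfolding pos_def_matrix_def by blast
  have "0 < d i" for i
  proof -
    let ?v = "Q *v axis i 1"
    have QQ: "transpose Q *v ?v = axis i 1"
      using Q by (simp add: matrix_vector_mul_assoc orthogonal_matrix_def)
    then have "?v \<noteq> 0" by (metis axis_eq_0_iff matrix_vector_mult_0_right zero_neq_one)
    then have "0 < ?v \<bullet> (A *v ?v)" using assms by (simp add: pos_def_matrix_def)
    also have "A *v ?v = Q *v (diag_matrix d *v axis i 1)"
      unfolding A matrix_vector_mul_assoc[symmetric] QQ ..
    also have "?v \<bullet> \<dots> = axis i 1 \<bullet> (diag_matrix d *v axis i 1)"
      unfolding inner_matrix_vector_mult QQ ..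
    also have "\<dots> = d i"
      by (simp add: diag_matrix_vector_mult inner_axis')
    finally show ?thesis .
  qed
  with Q A show thesis using that by blast
qed

section \<open>Gaussian integrals\<close>

lemma nn_integral_lborel_translation:
  fixes h :: "'a::euclidean_space \<Rightarrow> ennreal"
  assumes [measurable]: "h \<in> borel_measurable borel"
  shows "(\<integral>\<^sup>+x. h (c + x) \<partial>lborel) = (\<integral>\<^sup>+x. h x \<partial>lborel)"
  by (subst (2) lborel_distr_plus[of c, symmetric]) (simp add: nn_integral_distr)

lemma nn_integral_lborel_reflection:
  fixes h :: "'a::euclidean_space \<Rightarrow> ennreal"
  assumes [measurable]: "h \<in> borel_measurable borel"
  shows "(\<integral>\<^sup>+x. h (c - x) \<partial>lborel) = (\<integral>\<^sup>+x. h x \<partial>lborel)"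
  by (subst (2) lborel_affine[of "-1" c]) (simp_all add: nn_integral_density nn_integral_distr)

text \<open>
  The change-of-variables theorems of HOL-Analysis need a well-ordered index type. Here the
  invariance comes from uniqueness of Haar measure: compare \<open>distr lborel borel f\<close> with
  \<open>lborel\<close> through Fubini, normalizing on the unit ball, which \<open>f\<close> preserves.
\<close>
lemma lborel_distr_orthogonal_transformation:
  fixes f :: "'a::euclidean_space \<Rightarrow> 'a"
  assumes f: "orthogonal_transformation f"
  shows "distr lborel borel f = lborel"
proof (rule measure_eqI)
  fix A :: "'a set" assume "A \<in> sets (distr lborel borel f)"
  then have A[measurable]: "A \<in> sets borel" by simp
  have lin: "linear f" using f by (rule orthogonal_transformation_linear)
  have [measurable]: "f \<in> borel_measurable borel"
    by (intro borel_measurable_continuous_onI linear_continuous_on linear_conv_bounded_linear[THEN iffD1] lin)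
  let ?F = "indicator A :: 'a \<Rightarrow> ennreal"
  let ?g = "indicator (ball 0 1) :: 'a \<Rightarrow> ennreal"
  let ?N = "\<integral>\<^sup>+x. ?g x \<partial>lborel"
  have [measurable]: "ball (0::'a) 1 \<in> sets borel" by simp
  \<comment> \<open>Translation invariance of the image measure: by surjectivity a shift of
    \<open>f x\<close> is the image of a shift of \<open>x\<close>.\<close>
  have shift: "(\<integral>\<^sup>+x. h (f x + y) \<partial>lborel) = (\<integral>\<^sup>+x. h (f x) \<partial>lborel)"
    if [measurable]: "h \<in> borel_measurable borel" for h :: "'a \<Rightarrow> ennreal" and y
  proof -
    obtain z where "y = f z" using orthogonal_transformation_surj[OF f] by (metis surjD)
    then have "h (f x + y) = h (f (z + x))" for x
      by (simp add: linear_add[OF lin] add.commute)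
    then show ?thesis
      using nn_integral_lborel_translation[of "\<lambda>x. h (f x)" z] by simp
  qed
  have gf: "?g (f x) = ?g x" for x
    using f by (simp add: indicator_def orthogonal_transformation_norm)
  \<comment> \<open>Both products equal the double integral of
    \<open>?F (f x) * ?g (f x + y)\<close>. Integrating over \<open>y\<close> first gives the left
    one; shifting \<open>f x\<close> by \<open>y\<close> inside the \<open>x\<close> integral and
    then integrating over \<open>y\<close> by reflection gives the right one.\<close>
  have "(\<integral>\<^sup>+x. ?F (f x) \<partial>lborel) * ?N = (\<integral>\<^sup>+x. ?F (f x) * (\<integral>\<^sup>+y. ?g (f x + y) \<partial>lborel) \<partial>lborel)"
    by (simp add: nn_integral_lborel_translation nn_integral_multc)
  also have "\<dots> = (\<integral>\<^sup>+x. (\<integral>\<^sup>+y. ?F (f x) * ?g (f x + y) \<partial>lborel) \<partial>lborel)"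
    by (simp add: nn_integral_cmult)
  also have "\<dots> = (\<integral>\<^sup>+y. (\<integral>\<^sup>+x. ?F (f x) * ?g (f x + y) \<partial>lborel) \<partial>lborel)"
    by (rule lborel_pair.Fubini') measurable
  also have "\<dots> = (\<integral>\<^sup>+y. (\<integral>\<^sup>+x. ?F (f x - y) * ?g (f x) \<partial>lborel) \<partial>lborel)"
    using shift[of "\<lambda>u. ?F (u - y) * ?g u" y for y] by simp
  also have "\<dots> = (\<integral>\<^sup>+x. (\<integral>\<^sup>+y. ?F (f x - y) * ?g (f x) \<partial>lborel) \<partial>lborel)"
    by (rule lborel_pair.Fubini') measurable
  also have "\<dots> = (\<integral>\<^sup>+x. emeasure lborel A * ?g x \<partial>lborel)"
    by (simp add: nn_integral_multc nn_integral_lborel_reflection gf)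
  also have "\<dots> = emeasure lborel A * ?N"
    by (simp add: nn_integral_cmult)
  finally have "(\<integral>\<^sup>+x. ?F (f x) \<partial>lborel) * ?N = emeasure lborel A * ?N" .
  moreover have "?N \<noteq> 0" "?N \<noteq> top"
    using emeasure_lborel_ball_finite[of "0::'a" 1] open_not_negligible[of "ball (0::'a) 1"] 
    by (auto simp: negligible_iff_emeasure0)
  ultimately have "(\<integral>\<^sup>+x. ?F (f x) \<partial>lborel) = emeasure lborel A"
    by (metis ennreal_mult_cancel_left mult.commute)
  then show "emeasure (distr lborel borel f) A = emeasure lborel A"
    using nn_integral_distr[of f lborel borel ?F] by simp
qed simp

lemma borel_measurable_matrix_vector_mult [measurable]:
  "(\<lambda>x::real^'n. (A::real^'n^'m) *v x) \<in> borel_measurable borel"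
  by (intro borel_measurable_continuous_onI continuous_intros)

lemma bij_betw_axis_Basis: "bij_betw (\<lambda>i. axis i 1) UNIV (Basis :: (real^'n) set)"
  by (auto simp: bij_betw_def inj_on_def axis_eq_axis Basis_vec_def)

lemma integral_lborel_stretch_cart:
  fixes f :: "real^'n \<Rightarrow> real"
  assumes [measurable]: "f \<in> borel_measurable borel" and e: "\<And>i. 0 < e i"
  shows "(\<integral>x. f x \<partial>lborel) = (\<Prod>i\<in>UNIV. e i) * (\<integral>x. f (diag_matrix e *v x) \<partial>lborel)"
proof -
  let ?c = "\<lambda>j::real^'n. e (axis_index j)"
  \<comment> \<open>The left side is the map of \<open>lborel_affine_euclidean\<close> with offset
    0, which is why the \<open>0 +\<close> is kept.\<close>
  have T: "0 + (\<Sum>j\<in>Basis. (?c j * (x \<bullet> j)) *\<^sub>R j) = diag_matrix e *v x" for x :: "real^'n"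
  proof -
    have "(\<Sum>j\<in>Basis. (?c j * (x \<bullet> j)) *\<^sub>R j) = (\<Sum>i\<in>UNIV. (e i * x $ i) *\<^sub>R axis i 1)"
      by (subst sum.reindex_bij_betw[OF bij_betw_axis_Basis, symmetric])
        (simp add: axis_index_axis inner_axis)
    then show ?thesis
      by (simp add: vec_eq_iff diag_matrix_vector_mult axis_def if_distrib[of "\<lambda>a. _ * a"] cong: if_cong)
  qed
  have P: "(\<Prod>j\<in>Basis. \<bar>?c j\<bar>) = (\<Prod>i\<in>UNIV. e i)"
    by (subst prod.reindex_bij_betw[OF bij_betw_axis_Basis, symmetric])
      (simp add: axis_index_axis less_imp_le[OF e])
  have "lborel = density (distr lborel borel (\<lambda>x. diag_matrix e *v x)) (\<lambda>_. ennreal (\<Prod>i\<in>UNIV. e i))"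
    using lborel_affine_euclidean[of ?c 0] e unfolding T P by (simp add: less_imp_neq[symmetric])
  then have "(\<integral>x. f x \<partial>lborel)
      = (\<integral>x. f x \<partial>density (distr lborel borel (\<lambda>x. diag_matrix e *v x)) (\<lambda>_. ennreal (\<Prod>i\<in>UNIV. e i)))"
    by simp
  also have "\<dots> = (\<Prod>i\<in>UNIV. e i) * (\<integral>x. f (diag_matrix e *v x) \<partial>lborel)"
    by (subst integral_density) (simp_all add: integral_distr prod_nonneg less_imp_le[OF e])
  finally show ?thesis .
qed

text \<open>Translation, rotation and coordinatewise stretching are applied in turn; only the
  stretching contributes a Jacobian.\<close>

lemma integral_lborel_affine_cart:
  fixes f :: "real^'n \<Rightarrow> real"
  assumes [measurable]: "f \<in> borel_measurable borel" and Q: "orthogonal_matrix Q" and e: "\<And>i. 0 < e i"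
  shows "(\<integral>x. f x \<partial>lborel) = (\<Prod>i\<in>UNIV. e i) * (\<integral>x. f (m + (Q ** diag_matrix e) *v x) \<partial>lborel)"
proof -
  have "orthogonal_transformation ((*v) Q)"
    using Q by (simp add: orthogonal_transformation_matrix)
  then have distr_Q: "distr lborel borel ((*v) Q) = lborel"
    by (rule lborel_distr_orthogonal_transformation)
  have "(\<integral>x. f x \<partial>lborel) = (\<integral>x. f (m + x) \<partial>lborel)"
    by (subst lborel_distr_plus[of m, symmetric]) (simp add: integral_distr)
  also have "\<dots> = (\<integral>x. f (m + Q *v x) \<partial>lborel)"
    by (subst distr_Q[symmetric]) (simp add: integral_distr)
  also have "\<dots> = (\<Prod>i\<in>UNIV. e i) * (\<integral>x. f (m + Q *v (diag_matrix e *v x)) \<partial>lborel)"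
    using e by (intro integral_lborel_stretch_cart) simp_all
  finally show ?thesis by (simp add: matrix_vector_mul_assoc)
qed

text \<open>Fubini for the description of Lebesgue measure as an image of the product measure over
  \<open>Basis\<close>; \<open>axis_index\<close> translates between basis vectors and
  coordinates.\<close>

lemma has_bochner_integral_lborel_prod_cart:
  fixes g :: "'n::finite \<Rightarrow> real \<Rightarrow> real"
  assumes g: "\<And>i. has_bochner_integral lborel (g i) (c i)"
  shows "has_bochner_integral lborel (\<lambda>x::real^'n. \<Prod>i\<in>UNIV. g i (x $ i)) (\<Prod>i\<in>UNIV. c i)"
proof -
  let ?h = "\<lambda>b::real^'n. g (axis_index b)"
  interpret product_sigma_finite "\<lambda>_::real^'n. lborel::real measure" by standard
  have int: "integrable lborel (?h b)" "integral\<^sup>L lborel (?h b) = c (axis_index b)" for b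
    using g by (auto simp: has_bochner_integral_iff)
  have [measurable]: "?h b \<in> borel_measurable borel" for b
    using int(1)[of b] by (auto dest: borel_measurable_integrable)
  have prod_eq: "(\<Prod>i\<in>UNIV. g i (x $ i)) = (\<Prod>b\<in>Basis. ?h b (x \<bullet> b))" for x :: "real^'n"
    by (subst prod.reindex_bij_betw[OF bij_betw_axis_Basis, symmetric])
      (simp add: axis_index_axis inner_axis)
  have c_eq: "(\<Prod>i\<in>UNIV. c i) = (\<Prod>b\<in>(Basis::(real^'n) set). c (axis_index b))"
    by (subst prod.reindex_bij_betw[OF bij_betw_axis_Basis, symmetric]) (simp add: axis_index_axis)
  show ?thesis
    unfolding has_bochner_integral_iff prod_eq c_eq
    by (subst (1 2) lborel_eq)
      (simp add: integrable_distr_eq integral_distr product_integrable_prod[of Basis ?h]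
        product_integral_prod[of Basis ?h] int cong: prod.cong)
qed

section \<open>Moments of the standard Gaussian\<close>

definition std_gauss :: "real^'n \<Rightarrow> real" where
  "std_gauss z = (\<Prod>i\<in>UNIV. std_normal_density (z $ i))"

lemma std_gauss_eq: "std_gauss (z::real^'n) = exp (- (z \<bullet> z) / 2) / sqrt ((2 * pi) ^ CARD('n))"
proof -
  have "std_gauss z = 1 / sqrt (2 * pi) ^ CARD('n) * exp (\<Sum>i\<in>UNIV. - (z $ i)\<^sup>2 / 2)"
    by (simp add: std_gauss_def std_normal_density_def prod.distrib exp_sum prod_dividef)
  also have "(\<Sum>i\<in>UNIV. - (z $ i)\<^sup>2 / 2) = - (z \<bullet> z) / 2"
    by (simp add: inner_vec_def power2_eq_square sum_negf sum_divide_distrib)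
  finally show ?thesis by (simp add: real_sqrt_power[symmetric] del: power_mult_distrib)
qed

text \<open>The product form of \<open>std_gauss\<close> splits the integral into one-dimensional
  standard normal moments; those of order 0, 1 and 2 are 1, 0 and 1.\<close>

lemma std_gauss_monomial:
  fixes p :: "'n::finite \<Rightarrow> nat"
  assumes "\<And>k. p k \<le> 2"
  shows "has_bochner_integral lborel (\<lambda>z::real^'n. std_gauss z * (\<Prod>k\<in>UNIV. (z $ k) ^ p k))
           (\<Prod>k\<in>UNIV. if p k = 1 then 0 else 1)"
proof -
  have "has_bochner_integral lborel (\<lambda>t. std_normal_density t * t ^ p k) (if p k = 1 then 0 else 1)" for k
  proof -
    consider "p k = 0" | "p k = 1" | "p k = 2" using assms[of k] by linarith
    then show ?thesis
      using std_normal_moment_even[of 0] std_normal_moment_odd[of 0] std_normal_moment_even[of 1]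
      by cases simp_all
  qed
  from has_bochner_integral_lborel_prod_cart[OF this] show ?thesis
    by (simp add: std_gauss_def prod.distrib)
qed

lemma prod_power_indicator:
  fixes z :: "real^'n"
  shows "(\<Prod>k\<in>UNIV. (z $ k) ^ (if k = i then 1 else 0)) = z $ i"
proof -
  have "(z $ k) ^ (if k = i then 1 else 0) = (if k = i then z $ k else 1)" for k by simp
  then show ?thesis by (simp only: prod.delta finite UNIV_I if_True)
qed

lemma std_gauss_moment_0: "has_bochner_integral lborel (\<lambda>z::real^'n. std_gauss z) 1"
  using std_gauss_monomial[of "\<lambda>_::'n. 0"] by simp

lemma std_gauss_moment_1: "has_bochner_integral lborel (\<lambda>z::real^'n. std_gauss z * z $ i) 0"
proof -
  let ?p = "\<lambda>k. if k = i then 1 else (0::nat)"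
  have "(\<Prod>k\<in>UNIV. if ?p k = 1 then 0 else (1::real)) = 0"
    by (rule prod_zero) auto
  moreover have "?p k \<le> 2" for k by simp
  ultimately show ?thesis
    using std_gauss_monomial[of ?p] unfolding prod_power_indicator by metis
qed

lemma std_gauss_moment_2:
  "has_bochner_integral lborel (\<lambda>z::real^'n. std_gauss z * (z $ i * z $ j)) (if i = j then 1 else 0)"
proof -
  \<comment> \<open>For \<open>i = j\<close> the exponent is 2 there and never 1; for distinct
    indices it is 1 at \<open>i\<close>, which makes the product vanish.\<close>
  let ?p = "\<lambda>k. (if k = i then 1 else (0::nat)) + (if k = j then 1 else 0)"
  have "(\<Prod>k\<in>UNIV. if ?p k = 1 then 0 else (1::real)) = (if i = j then 1 else 0)"
    by (auto intro!: prod_zero prod.neutral bexI[of _ i])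
  then show ?thesis
    using std_gauss_monomial[of ?p] unfolding power_add prod.distrib prod_power_indicator by simp
qed

text \<open>The linear part has mean 0, and the identity covariance keeps only the diagonal of
  \<open>N\<close>.\<close>

lemma std_gauss_quadratic:
  fixes v :: "real^'n" and N :: "real^'n^'n"
  shows "has_bochner_integral lborel (\<lambda>z. std_gauss z * (k + v \<bullet> z + z \<bullet> (N *v z))) (k + trace N)"
proof -
  have eq: "std_gauss z * (k + v \<bullet> z + z \<bullet> (N *v z)) =
      std_gauss z * k + (\<Sum>i\<in>UNIV. v $ i * (std_gauss z * z $ i))
       + (\<Sum>i\<in>UNIV. \<Sum>j\<in>UNIV. N $ i $ j * (std_gauss z * (z $ i * z $ j)))" for z
    by (simp add: inner_vec_def matrix_vector_mult_def sum_distrib_left algebra_simps)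
  have "trace N = (\<Sum>i\<in>UNIV. \<Sum>j\<in>UNIV. N $ i $ j * (if i = j then 1 else 0))"
    by (simp add: trace_def if_distrib[of "\<lambda>a. _ * a"] cong: if_cong)
  \<comment> \<open>The value is spelled out in the summation pattern of \<open>eq\<close>, so that
    the integrals match term by term.\<close>
  then have "k + trace N = 1 * k + (\<Sum>i\<in>UNIV. v $ i * 0)
       + (\<Sum>i\<in>UNIV. \<Sum>j\<in>UNIV. N $ i $ j * (if i = j then 1 else 0))"
    by simp
  then show ?thesis
    unfolding eq
    by (simp only:) (intro has_bochner_integral_add has_bochner_integral_sum
      has_bochner_integral_mult_right has_bochner_integral_mult_left
      std_gauss_moment_0 std_gauss_moment_1 std_gauss_moment_2)
qed

section \<open>Gaussian densities and the closed form of their divergence\<close>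

lemma borel_measurable_gauss_density [measurable]: "gauss_density m S \<in> borel_measurable borel"
proof -
  have "(\<lambda>x. matrix_inv S *v (x - m)) \<in> borel_measurable borel"
    by measurable
  then show ?thesis
    unfolding gauss_density_def by measurable
qed

lemma matrix_inv_unique:
  fixes A B :: "real^'n^'n"
  assumes "A ** B = mat 1"
  shows "matrix_inv A = B"
proof -
  have BA: "B ** A = mat 1" using assms by (simp add: matrix_left_right_inverse)
  have "\<exists>C. A ** C = mat 1 \<and> C ** A = mat 1" using assms BA by blast
  then have "matrix_inv A ** A = mat 1"
    unfolding matrix_inv_def by (rule someI2_ex) simp
  then show ?thesis
    by (metis assms matrix_mul_assoc matrix_mul_lid matrix_mul_rid)
qed

text \<open>From \<open>S = Q ** diag_matrix d ** transpose Q\<close> take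
  \<open>L = Q ** diag_matrix e\<close> with \<open>e\<close> the square roots of \<open>d\<close>,
  and \<open>K\<close> its inverse. Substituting \<open>x = m + L *v z\<close> turns the quadratic
  form into \<open>z \<bullet> z\<close>, and the Jacobian cancels the square root of
  \<open>det S\<close>.\<close>

lemma gauss_density_factorization:
  fixes S :: "real^'n^'n"
  assumes "pos_def_matrix S"
  obtains L K :: "real^'n^'n" where "S = L ** transpose L" "L ** K = mat 1" "K ** L = mat 1" "0 < det S"
    "matrix_inv S = transpose K ** K"
    "\<forall>f\<in>borel_measurable borel. \<forall>m.
      (\<integral>x. gauss_density m S x * f x \<partial>lborel) = (\<integral>z. std_gauss z * f (m + L *v z) \<partial>lborel)"
proof -
  obtain Q d where Q: "orthogonal_matrix Q" and S: "S = Q ** diag_matrix d ** transpose Q"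
    and d: "\<And>i. 0 < d i"
    using pos_def_matrix_diagonalization[OF assms] by blast
  define e where "e = (\<lambda>i. sqrt (d i))"
  have e: "0 < e i" for i using d by (simp add: e_def)
  define L where "L = Q ** diag_matrix e"
  define K where "K = diag_matrix (\<lambda>i. 1 / e i) ** transpose Q"
  have QQ: "Q ** transpose Q = mat 1" "transpose Q ** Q = mat 1"
    using Q by (auto simp: orthogonal_matrix_def)
  have dd: "diag_matrix e ** diag_matrix e = diag_matrix d"
    using d by (simp add: diag_matrix_mult e_def less_imp_le)
  have SL: "S = L ** transpose L"
    unfolding S L_def by (simp add: matrix_transpose_mul dd[symmetric] matrix_mul_assoc)
  have KL: "K ** L = mat 1"
  proof -
    have "K ** L = diag_matrix (\<lambda>i. 1 / e i) ** (transpose Q ** Q) ** diag_matrix e"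
      by (simp add: K_def L_def matrix_mul_assoc)
    also have "\<dots> = mat 1"
      using e by (simp add: QQ diag_matrix_mult diag_matrix_1 less_imp_neq[symmetric])
    finally show ?thesis .
  qed
  then have LK: "L ** K = mat 1" by (simp add: matrix_left_right_inverse)
  have inv: "matrix_inv S = transpose K ** K"
  proof (rule matrix_inv_unique)
    have "S ** (transpose K ** K) = L ** transpose (K ** L) ** K"
      by (simp add: SL matrix_transpose_mul matrix_mul_assoc)
    then show "S ** (transpose K ** K) = mat 1" by (simp add: KL LK)
  qed
  have detS: "det S = (\<Prod>i\<in>UNIV. e i)\<^sup>2"
  proof -
    have "det S = det (diag_matrix d) * (det Q * det (transpose Q))"
      by (simp add: S det_mul)
    also have "det Q * det (transpose Q) = 1" by (metis QQ(1) det_I det_mul)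
    finally show ?thesis
      by (simp add: dd[symmetric] det_mul det_diag_matrix power2_eq_square)
  qed
  have pe: "0 < (\<Prod>i\<in>UNIV. e i)" using e by (simp add: prod_pos)
  have dens: "(\<Prod>i\<in>UNIV. e i) * gauss_density m S (m + L *v z) = std_gauss z" for m z
  proof -
    have "(L *v z) \<bullet> (matrix_inv S *v (L *v z)) = (K *v (L *v z)) \<bullet> (K *v (L *v z))"
      by (simp only: inv inner_transpose_mult)
    also have "\<dots> = z \<bullet> z" by (simp add: matrix_vector_mul_assoc KL)
    finally have "(L *v z) \<bullet> (matrix_inv S *v (L *v z)) = z \<bullet> z" .
    then show ?thesis
      using pe e by (simp add: gauss_density_def std_gauss_eq detS real_sqrt_mult less_imp_neq[symmetric])
  qed
  have "(\<integral>x. gauss_density m S x * f x \<partial>lborel) = (\<integral>z. std_gauss z * f (m + L *v z) \<partial>lborel)"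
    if [measurable]: "f \<in> borel_measurable borel" for m f
  proof -
    have "(\<integral>x. gauss_density m S x * f x \<partial>lborel) = (\<Prod>i\<in>UNIV. e i) *
        (\<integral>z. gauss_density m S (m + L *v z) * f (m + L *v z) \<partial>lborel)"
      unfolding L_def by (rule integral_lborel_affine_cart[OF _ Q e]) measurable
    also have "\<dots> = (\<integral>z. (\<Prod>i\<in>UNIV. e i) * (gauss_density m S (m + L *v z) * f (m + L *v z)) \<partial>lborel)"
      by simp
    also have "\<dots> = (\<integral>z. std_gauss z * f (m + L *v z) \<partial>lborel)"
      by (simp only: mult.assoc[symmetric] dens)
    finally show ?thesis .
  qed
  moreover have "0 < det S" using pe unfolding detS by (rule zero_less_power)
  ultimately show thesis using that SL LK KL inv by blast
qed

text \<open>After the substitution \<open>x = m1 + L *v z\<close> the logarithm of the density ratio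
  is a quadratic polynomial in a standard Gaussian \<open>z\<close>, whose mean is known.\<close>

theorem KL_div_gauss:
  fixes S1 S2 :: "real^'n^'n"
  assumes S1: "pos_def_matrix S1" and S2: "pos_def_matrix S2"
  shows "2 * KL_div (gauss_density m1 S1) (gauss_density m2 S2) =
    ln (det S2) - ln (det S1) + trace (matrix_inv S2 ** S1) - real CARD('n)
      + (m1 - m2) \<bullet> (matrix_inv S2 *v (m1 - m2))"
proof -
  obtain L K :: "real^'n^'n" where L: "S1 = L ** transpose L" and LK: "L ** K = mat 1" "K ** L = mat 1"
    and d1: "0 < det S1" and inv: "matrix_inv S1 = transpose K ** K"
    and int: "\<forall>f\<in>borel_measurable borel. \<forall>m.
      (\<integral>x. gauss_density m S1 x * f x \<partial>lborel) = (\<integral>z. std_gauss z * f (m + L *v z) \<partial>lborel)"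
    by (rule gauss_density_factorization[OF S1], rule that)
  have d2: "0 < det S2" by (rule gauss_density_factorization[OF S2])
  define M where "M = matrix_inv S2"
  define \<delta> where "\<delta> = m1 - m2"
  \<comment> \<open>\<open>k\<close>, \<open>v\<close> and \<open>N\<close> are the constant, linear
    and quadratic coefficients of twice the log ratio. The \<open>mat 1\<close> comes from the first
    density, and \<open>v\<close> collects the two cross terms between \<open>\<delta>\<close> and
    \<open>L *v z\<close>.\<close>
  define N where "N = transpose L ** M ** L - mat 1"
  define v where "v = transpose L *v (M *v \<delta>) + transpose L *v (transpose M *v \<delta>)"
  define k where "k = ln (det S2) - ln (det S1) + \<delta> \<bullet> (M *v \<delta>)"
  have expand: "ln (gauss_density m1 S1 (m1 + L *v z) / gauss_density m2 S2 (m1 + L *v z))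
      = (k + v \<bullet> z + z \<bullet> (N *v z)) / 2" for z
  proof -
    let ?x = "m1 + L *v z"
    have lng: "ln (gauss_density m S x) = - ((x - m) \<bullet> (matrix_inv S *v (x - m))) / 2
        - ln ((2 * pi) ^ CARD('n)) / 2 - ln (det S) / 2" if "0 < det S" for m x and S :: "real^'n^'n"
      using that by (simp add: gauss_density_def ln_div ln_sqrt ln_mult field_simps)
    have pos: "0 < gauss_density m S x" if "0 < det S" for m x and S :: "real^'n^'n"
      using that by (simp add: gauss_density_def)
    have "2 * ln (gauss_density m1 S1 ?x / gauss_density m2 S2 ?x) =
        ln (det S2) - ln (det S1) + (?x - m2) \<bullet> (M *v (?x - m2))
          - (L *v z) \<bullet> (matrix_inv S1 *v (L *v z))"
      using pos[OF d1, of m1 ?x] pos[OF d2, of m2 ?x]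
      by (simp add: ln_div lng d1 d2 M_def)
    also have "(L *v z) \<bullet> (matrix_inv S1 *v (L *v z)) = (K *v (L *v z)) \<bullet> (K *v (L *v z))"
      by (simp only: inv inner_transpose_mult)
    also have "\<dots> = z \<bullet> z" by (simp add: matrix_vector_mul_assoc LK)
    also have "?x - m2 = \<delta> + L *v z" by (simp add: \<delta>_def)
    also have "(\<delta> + L *v z) \<bullet> (M *v (\<delta> + L *v z)) = \<delta> \<bullet> (M *v \<delta>) + v \<bullet> z + z \<bullet> ((transpose L ** M ** L) *v z)"
    proof -
      have "\<delta> \<bullet> (M *v (L *v z)) = (transpose L *v (transpose M *v \<delta>)) \<bullet> z"
        by (simp add: inner_matrix_vector_mult)
      moreover have "(L *v z) \<bullet> (M *v \<delta>) = (transpose L *v (M *v \<delta>)) \<bullet> z"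
        by (metis inner_commute inner_matrix_vector_mult)
      moreover have "(L *v z) \<bullet> (M *v (L *v z)) = z \<bullet> ((transpose L ** M ** L) *v z)"
        by (simp only: matrix_mul_assoc[symmetric] inner_transpose_mult matrix_vector_mul_assoc)
      ultimately show ?thesis
        by (simp add: v_def matrix_vector_right_distrib inner_add_left inner_add_right)
    qed
    also have "z \<bullet> ((transpose L ** M ** L) *v z) = z \<bullet> (N *v z) + z \<bullet> z"
      by (simp add: N_def matrix_vector_mult_diff_rdistrib inner_diff_right)
    finally show ?thesis by (simp add: k_def)
  qed
  have "KL_div (gauss_density m1 S1) (gauss_density m2 S2) =
      (\<integral>z. std_gauss z * ((k + v \<bullet> z + z \<bullet> (N *v z)) / 2) \<partial>lborel)"
    unfolding KL_div_def by (subst int[rule_format]) (simp_all add: expand)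
  also have "\<dots> = (k + trace N) / 2"
    using std_gauss_quadratic[of k v N] by (simp add: has_bochner_integral_iff)
  \<comment> \<open>Cyclicity of the trace moves \<open>transpose L\<close> behind \<open>L\<close>,
    where the two form \<open>S1\<close>.\<close>
  also have "trace N = trace (M ** S1) - real CARD('n)"
    using trace_mul_sym[of "transpose L" "M ** L"]
    by (simp add: N_def trace_sub trace_I L matrix_mul_assoc)
  finally show ?thesis by (simp add: k_def M_def \<delta>_def)
qed

section \<open>The triangle-type inequality\<close>

lemma matrix_diff_ldistrib: "A ** (B - C) = A ** B - A ** (C :: real^'n^'m)"
  by (simp add: matrix_matrix_mult_def vec_eq_iff right_diff_distrib sum_subtractf)

lemma matrix_diff_rdistrib: "(B - C) ** A = B ** A - (C :: real^'n^'m) ** A"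
  by (simp add: matrix_matrix_mult_def vec_eq_iff left_diff_distrib sum_subtractf)

text \<open>The inner product of the type \<open>real^'n^'n\<close> is the Frobenius product, so
  this brings traces within reach of Cauchy-Schwarz.\<close>

lemma trace_mult_symmetric:
  fixes X Y :: "real^'n^'n"
  assumes "transpose Y = Y"
  shows "trace (X ** Y) = X \<bullet> Y"
proof -
  have "Y $ j $ i = Y $ i $ j" for i j
    by (subst (2) assms[symmetric]) (simp add: transpose_def)
  then show ?thesis
    by (simp add: trace_def matrix_matrix_mult_def inner_vec_def)
qed

text \<open>Collects what is needed of the spectrum. Trace, determinant and Frobenius norm are
  unchanged by conjugation with \<open>Q\<close>, and the vector \<open>w\<close> is
  \<open>transpose Q *v v\<close>, the coordinates of \<open>v\<close> in the eigenbasis.\<close>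

lemma pos_def_matrix_eigenvalues:
  fixes A :: "real^'n^'n"
  assumes A: "pos_def_matrix A"
  obtains d :: "'n \<Rightarrow> real" where "\<forall>i. 0 < d i"
    "trace A - ln (det A) - real CARD('n) = (\<Sum>i\<in>UNIV. itakura_saito (d i))"
    "(norm (A - mat 1))\<^sup>2 = (\<Sum>i\<in>UNIV. (d i - 1)\<^sup>2)"
    "\<forall>v. \<exists>w. w \<bullet> w = v \<bullet> v \<and> v \<bullet> (A *v v) = (\<Sum>i\<in>UNIV. d i * (w $ i)\<^sup>2)"
proof -
  obtain Q d where Q: "orthogonal_matrix Q" and AQ: "A = Q ** diag_matrix d ** transpose Q"
    and d: "\<And>i. 0 < d i"
    using pos_def_matrix_diagonalization[OF A] by blast
  have QQ: "Q ** transpose Q = mat 1" "transpose Q ** Q = mat 1"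
    using Q by (auto simp: orthogonal_matrix_def)
  have trace_conj: "trace (Q ** X ** transpose Q) = trace X" for X
    by (subst trace_mul_sym) (simp add: matrix_mul_assoc QQ)
  have "det A = (\<Prod>i\<in>UNIV. d i)"
  proof -
    have "det A = det (diag_matrix d) * (det Q * det (transpose Q))"
      by (simp add: AQ det_mul)
    also have "det Q * det (transpose Q) = 1" by (metis QQ(1) det_I det_mul)
    finally show ?thesis by (simp add: det_diag_matrix)
  qed
  then have "ln (det A) = (\<Sum>i\<in>UNIV. ln (d i))" using d by (simp add: ln_prod order_less_imp_not_eq2)
  moreover have "trace A = (\<Sum>i\<in>UNIV. d i)" by (simp add: AQ trace_conj trace_diag_matrix)
  ultimately have tr: "trace A - ln (det A) - real CARD('n) = (\<Sum>i\<in>UNIV. itakura_saito (d i))"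
    by (simp add: itakura_saito_def sum_subtractf)
  let ?X = "A - mat 1"
  let ?D = "diag_matrix (\<lambda>i. d i - 1)"
  have X: "?X = Q ** ?D ** transpose Q"
  proof -
    have "Q ** ?D ** transpose Q = Q ** diag_matrix d ** transpose Q - Q ** mat 1 ** transpose Q"
      by (simp add: diag_matrix_diff[symmetric] diag_matrix_1 matrix_diff_ldistrib matrix_diff_rdistrib)
    then show ?thesis by (simp add: AQ QQ)
  qed
  have "transpose ?X = ?X" unfolding X by (simp add: matrix_transpose_mul matrix_mul_assoc)
  then have "(norm ?X)\<^sup>2 = trace (?X ** ?X)"
    by (simp add: trace_mult_symmetric power2_norm_eq_inner)
  also have "?X ** ?X = Q ** ?D ** (transpose Q ** Q) ** ?D ** transpose Q"
    unfolding X by (simp add: matrix_mul_assoc)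
  also have "\<dots> = Q ** (?D ** ?D) ** transpose Q"
    by (simp add: QQ matrix_mul_assoc)
  finally have nX: "(norm ?X)\<^sup>2 = (\<Sum>i\<in>UNIV. (d i - 1)\<^sup>2)"
    by (simp add: trace_conj diag_matrix_mult trace_diag_matrix power2_eq_square)
  have quad: "\<exists>w. w \<bullet> w = v \<bullet> v \<and> v \<bullet> (A *v v) = (\<Sum>i\<in>UNIV. d i * (w $ i)\<^sup>2)" for v
  proof (intro exI conjI)
    let ?w = "transpose Q *v v"
    show "?w \<bullet> ?w = v \<bullet> v"
      using inner_transpose_mult[of v "transpose Q" "transpose Q" v] by (simp add: QQ)
    have "v \<bullet> (A *v v) = ?w \<bullet> (diag_matrix d *v ?w)"
      by (simp add: AQ inner_matrix_vector_mult[of v Q] flip: matrix_vector_mul_assoc)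
    then show "v \<bullet> (A *v v) = (\<Sum>i\<in>UNIV. d i * (?w $ i)\<^sup>2)"
      by (simp add: diag_matrix_vector_mult inner_vec_def power2_eq_square mult_ac)
  qed
  show thesis
  proof (rule that)
    show "\<forall>i. 0 < d i" using d by simp
  qed (use tr nX quad in simp_all)
qed

lemma pos_def_matrix_transpose_mult:
  fixes P :: "real^'n^'n"
  assumes "R ** P = mat 1"
  shows "pos_def_matrix (transpose P ** P)"
  unfolding pos_def_matrix_def
proof (intro conjI allI impI)
  show "transpose (transpose P ** P) = transpose P ** P"
    by (simp add: matrix_transpose_mul)
  fix v :: "real^'n" assume "v \<noteq> 0"
  moreover have "R *v (P *v v) = v" by (simp add: matrix_vector_mul_assoc assms)
  ultimately have "P *v v \<noteq> 0" by auto
  moreover have "v \<bullet> ((transpose P ** P) *v v) = (P *v v) \<bullet> (P *v v)"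
    by (rule inner_transpose_mult)
  ultimately show "0 < v \<bullet> ((transpose P ** P) *v v)" by simp
qed

text \<open>The inequality in whitened coordinates, with all divergences doubled: \<open>A\<close>
  is the first covariance, \<open>B\<close> the third precision matrix, \<open>m\<close> and
  \<open>m'\<close> the mean differences. The numbers \<open>\<alpha>\<close>,
  \<open>\<beta>\<close>, \<open>\<gamma>\<close> stand for \<open>- a\<close>, \<open>- b\<close>,
  \<open>- c\<close>.\<close>

lemma relative_divergence_bound:
  fixes A B :: "real^'n^'n" and m m' :: "real^'n"
  assumes A: "pos_def_matrix A" and B: "pos_def_matrix B" and e: "0 < e1" "0 < e2"
    and le1: "trace A - ln (det A) - real CARD('n) + m \<bullet> m \<le> e1"
    and le2: "trace B - ln (det B) - real CARD('n) + m' \<bullet> (B *v m') \<le> e2"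
    and \<alpha>: "1 \<le> \<alpha>" "itakura_saito \<alpha> = e1"
    and \<beta>: "1 \<le> \<beta>" "itakura_saito \<beta> = e2"
    and \<gamma>: "0 < \<gamma>" "\<gamma> \<le> 1" "itakura_saito \<gamma> = e2"
  shows "trace (B ** A) - ln (det A) - ln (det B) - real CARD('n) + (m + m') \<bullet> (B *v (m + m'))
    < e1 + e2 + (\<alpha> - 1) * (\<beta> - 1) + \<beta> * (sqrt e1 + sqrt (e2 / \<gamma>))\<^sup>2"
proof -
  obtain a :: "'n \<Rightarrow> real" where a: "\<forall>i. 0 < a i"
    and trA: "trace A - ln (det A) - real CARD('n) = (\<Sum>i\<in>UNIV. itakura_saito (a i))"
    and nA: "(norm (A - mat 1))\<^sup>2 = (\<Sum>i\<in>UNIV. (a i - 1)\<^sup>2)"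
    by (rule pos_def_matrix_eigenvalues[OF A], rule that)
  obtain b :: "'n \<Rightarrow> real" where b: "\<forall>i. 0 < b i"
    and trB: "trace B - ln (det B) - real CARD('n) = (\<Sum>i\<in>UNIV. itakura_saito (b i))"
    and nB: "(norm (B - mat 1))\<^sup>2 = (\<Sum>i\<in>UNIV. (b i - 1)\<^sup>2)"
    and qB: "\<forall>v. \<exists>w. w \<bullet> w = v \<bullet> v \<and> v \<bullet> (B *v v) = (\<Sum>i\<in>UNIV. b i * (w $ i)\<^sup>2)"
    by (rule pos_def_matrix_eigenvalues[OF B], rule that)
  let ?P = "\<Sum>i\<in>UNIV. itakura_saito (a i)"
  let ?R = "\<Sum>i\<in>UNIV. itakura_saito (b i)"
  let ?q = "m' \<bullet> (B *v m')"
  have "0 \<le> ?P" using a by (simp add: sum_nonneg itakura_saito_nonneg)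
  have "0 \<le> ?R" using b by (simp add: sum_nonneg itakura_saito_nonneg)
  have q_nonneg: "0 \<le> ?q"
    using B unfolding pos_def_matrix_def by (cases "m' = 0") (auto intro: less_imp_le)
  \<comment> \<open>Covariance part and mean part are both nonnegative, so each alone stays within
    the budget.\<close>
  have P: "?P \<le> e1" "m \<bullet> m \<le> e1" using le1 trA \<open>0 \<le> ?P\<close> inner_ge_zero[of m] by linarith+
  have R: "?R \<le> e2" "?q \<le> e2" using le2 trB \<open>0 \<le> ?R\<close> q_nonneg by linarith+
  have "norm (A - mat 1) \<le> \<alpha> - 1"
  proof (rule power2_le_imp_le)
    show "(norm (A - mat 1))\<^sup>2 \<le> (\<alpha> - 1)\<^sup>2"
      unfolding nA using a \<alpha> P(1) by (intro sum_squares_le_of_itakura_saito) simp_all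
  qed (use \<alpha> in simp)
  moreover have "norm (B - mat 1) \<le> \<beta> - 1"
  proof (rule power2_le_imp_le)
    show "(norm (B - mat 1))\<^sup>2 \<le> (\<beta> - 1)\<^sup>2"
      unfolding nB using b \<beta> R(1) by (intro sum_squares_le_of_itakura_saito) simp_all
  qed (use \<beta> in simp)
  ultimately have cs: "(B - mat 1) \<bullet> (A - mat 1) \<le> (\<alpha> - 1) * (\<beta> - 1)"
    using norm_cauchy_schwarz[of "B - mat 1" "A - mat 1"] \<beta>
      mult_mono[of "norm (B - mat 1)" "\<beta> - 1" "norm (A - mat 1)" "\<alpha> - 1"]
    by (simp add: mult.commute)
  have "transpose (A - mat 1) = A - mat 1"
    using A by (simp add: pos_def_matrix_def transpose_def mat_def vec_eq_iff)
  then have "(B - mat 1) \<bullet> (A - mat 1) = trace ((B - mat 1) ** (A - mat 1))"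
    by (simp add: trace_mult_symmetric)
  also have "\<dots> = trace (B ** A) - trace A - trace B + real CARD('n)"
    by (simp add: matrix_diff_ldistrib matrix_diff_rdistrib trace_sub trace_I)
  \<comment> \<open>Splits the coupled trace into the two separate divergences and a correction
    already bounded by \<open>cs\<close>.\<close>
  finally have tr: "trace (B ** A) = (B - mat 1) \<bullet> (A - mat 1) + trace A + trace B - real CARD('n)"
    by simp
  \<comment> \<open>A single nonnegative summand of \<open>?R\<close> is at most \<open>e2\<close>,
    the common value at \<open>\<gamma>\<close> and \<open>\<beta>\<close>.\<close>
  have bi: "\<gamma> \<le> b i" "b i \<le> \<beta>" for i
  proof -
    have "itakura_saito (b i) \<le> e2"
      using R(1) b member_le_sum[of i UNIV "\<lambda>i. itakura_saito (b i)"] itakura_saito_nonneg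
      by force
    then show "\<gamma> \<le> b i" "b i \<le> \<beta>"
      using itakura_saito_le_imp_bounds[of "b i" \<gamma> \<beta>] b \<beta> \<gamma> by auto
  qed
  have q_bounds: "\<gamma> * (v \<bullet> v) \<le> v \<bullet> (B *v v)" "v \<bullet> (B *v v) \<le> \<beta> * (v \<bullet> v)" for v
  proof -
    obtain w where w: "w \<bullet> w = v \<bullet> v" "v \<bullet> (B *v v) = (\<Sum>i\<in>UNIV. b i * (w $ i)\<^sup>2)"
      using qB by blast
    have "\<kappa> * (v \<bullet> v) = (\<Sum>i\<in>UNIV. \<kappa> * (w $ i)\<^sup>2)" for \<kappa>
      unfolding w(1)[symmetric] by (simp add: inner_vec_def sum_distrib_left power2_eq_square)
    then show "\<gamma> * (v \<bullet> v) \<le> v \<bullet> (B *v v)" "v \<bullet> (B *v v) \<le> \<beta> * (v \<bullet> v)"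
      unfolding w(2) by (simp_all add: sum_mono mult_right_mono bi)
  qed
  let ?s = "sqrt e1 + sqrt (e2 / \<gamma>)"
  have "0 < ?s" using e \<gamma> by (simp add: add_pos_pos)
  \<comment> \<open>The smallest eigenvalue bound gives
    \<open>\<gamma> * (m' \<bullet> m') \<le> ?q \<le> e2\<close>, hence the second summand of
    \<open>?s\<close>; the triangle inequality and the largest eigenvalue bound do the rest.\<close>
  have quad: "(m + m') \<bullet> (B *v (m + m')) \<le> \<beta> * ?s\<^sup>2"
  proof -
    have "norm m \<le> sqrt e1" using P(2) by (simp add: norm_eq_sqrt_inner)
    moreover have "norm m' \<le> sqrt (e2 / \<gamma>)"
      using q_bounds(1)[of m'] R(2) \<gamma> by (simp add: norm_eq_sqrt_inner pos_le_divide_eq mult.commute)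
    ultimately have "norm (m + m') \<le> ?s" using norm_triangle_ineq[of m m'] by linarith
    then have "(m + m') \<bullet> (m + m') \<le> ?s\<^sup>2"
      by (metis norm_ge_zero power2_norm_eq_inner power_mono)
    then have "\<beta> * ((m + m') \<bullet> (m + m')) \<le> \<beta> * ?s\<^sup>2" using \<beta> by (intro mult_left_mono) auto
    then show ?thesis using q_bounds(2)[of "m + m'"] by linarith
  qed
  have "(m + m') \<bullet> (B *v (m + m')) - m \<bullet> m - ?q < \<beta> * ?s\<^sup>2"
  proof (cases "m = 0 \<and> m' = 0")
    \<comment> \<open>Strictness: either a mean term is discarded, or the quadratic form vanishes.\<close>
    case True
    then show ?thesis using \<beta> \<open>0 < ?s\<close> by simp
  next
    case False
    then have "0 < m \<bullet> m \<or> 0 < ?q" using B by (auto simp: pos_def_matrix_def)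
    then have "0 < m \<bullet> m + ?q" using q_nonneg inner_ge_zero[of m] by linarith
    then show ?thesis using quad by linarith
  qed
  then show ?thesis using tr cs le1 le2 by linarith
qed

theorem theorem4:
  fixes eps1 eps2 :: real
    and mu1 mu2 mu3 :: "real^'n"
    and S1 S2 S3 :: "real^'n^'n"
  assumes "eps1 > 0" and "eps2 > 0"
    and "pos_def_matrix S1" and "pos_def_matrix S2" and "pos_def_matrix S3"
    and "KL_div (gauss_density mu1 S1) (gauss_density mu2 S2) \<le> eps1"
    and "KL_div (gauss_density mu2 S2) (gauss_density mu3 S3) \<le> eps2"
  shows "let a = lambertWm1 (- exp (- (1 + 2 * eps1)));
             b = lambertWm1 (- exp (- (1 + 2 * eps2)));
             c = lambertW0 (- exp (- (1 + 2 * eps2)))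
         in KL_div (gauss_density mu1 S1) (gauss_density mu3 S3)
            < eps1 + eps2 + (a * b + a + b + 1
                 - b * (sqrt (2 * eps1) + sqrt (2 * eps2 / (- c)))^2) / 2"
proof -
  obtain L1 K1 :: "real^'n^'n" where 1: "S1 = L1 ** transpose L1" "L1 ** K1 = mat 1" "0 < det S1"
    by (rule gauss_density_factorization[OF assms(3)], rule that)
  obtain L K :: "real^'n^'n" where 2: "S2 = L ** transpose L" "L ** K = mat 1" "K ** L = mat 1" "0 < det S2"
    and inv2: "matrix_inv S2 = transpose K ** K"
    by (rule gauss_density_factorization[OF assms(4)], rule that)
  obtain L3 K3 :: "real^'n^'n" where 3: "S3 = L3 ** transpose L3" "L3 ** K3 = mat 1" "K3 ** L3 = mat 1" "0 < det S3"
    and inv3: "matrix_inv S3 = transpose K3 ** K3"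
    by (rule gauss_density_factorization[OF assms(5)], rule that)
  let ?M = "matrix_inv S3"
  define A where "A = K ** S1 ** transpose K"
  define B where "B = transpose L ** ?M ** L"
  define m where "m = K *v (mu1 - mu2)"
  define m' where "m' = K *v (mu2 - mu3)"
  have tLK: "transpose K ** transpose L = mat 1" "transpose L ** transpose K = mat 1"
    using 2 by (simp_all flip: matrix_transpose_mul)
  have detKL: "det K * det L = 1" using 2 by (metis det_I det_mul)
  have detM: "det ?M * det S3 = 1"
  proof -
    have "det K3 * det L3 = 1" using 3 by (metis det_I det_mul)
    then have "(det K3 * det L3) * (det K3 * det L3) = 1" by simp
    then show ?thesis unfolding inv3 by (simp add: 3(1) det_mul mult_ac)
  qed
  have posA: "pos_def_matrix A"
  proof -
    have "(K ** L1) ** (K1 ** L) = K ** (L1 ** K1) ** L" by (simp add: matrix_mul_assoc)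
    also have "\<dots> = mat 1" using 1 2 by simp
    \<comment> \<open>\<open>A\<close> is the Gram matrix \<open>transpose P ** P\<close> of
      \<open>P = transpose (K ** L1)\<close>, so the left inverse is needed in transposed
      form.\<close>
    finally have "transpose (K1 ** L) ** transpose (K ** L1) = mat 1"
      by (metis matrix_transpose_mul transpose_mat)
    from pos_def_matrix_transpose_mult[OF this] show ?thesis
      by (simp add: A_def 1(1) matrix_transpose_mul matrix_mul_assoc)
  qed
  have posB: "pos_def_matrix B"
  proof -
    have "(K ** L3) ** (K3 ** L) = K ** (L3 ** K3) ** L" by (simp add: matrix_mul_assoc)
    also have "\<dots> = mat 1" using 3 2 by simp
    finally show ?thesis
      using pos_def_matrix_transpose_mult[of "K ** L3" "K3 ** L"]
      by (simp add: B_def inv3 matrix_transpose_mul matrix_mul_assoc)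
  qed
  have lnA: "ln (det A) = ln (det S1) - ln (det S2)"
  proof -
    have "det A * det S2 = det S1 * (det K * det L) * (det K * det L)"
      by (simp add: A_def 2(1) det_mul)
    then have "det A = det S1 / det S2" using 2(4) by (simp add: detKL eq_divide_eq)
    then show ?thesis using 1 2 by (simp add: ln_div)
  qed
  have lnB: "ln (det B) = ln (det S2) - ln (det S3)"
  proof -
    have "det B * det S3 = det S2 * (det ?M * det S3)"
      by (simp add: B_def 2(1) det_mul)
    then have "det B = det S2 / det S3" using 3(4) by (simp add: detM eq_divide_eq)
    then show ?thesis using 2 3 by (simp add: ln_div)
  qed
  have trA: "trace (matrix_inv S2 ** S1) = trace A"
    unfolding A_def inv2 by (metis matrix_mul_assoc trace_mul_sym)
  have trB: "trace (?M ** S2) = trace B"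
    unfolding B_def 2(1) by (metis matrix_mul_assoc trace_mul_sym)
  have trBA: "trace (?M ** S1) = trace (B ** A)"
  proof -
    have "B ** A = transpose L ** (?M ** (L ** K) ** S1 ** transpose K)"
      by (simp add: A_def B_def matrix_mul_assoc)
    then have "trace (B ** A) = trace (?M ** (L ** K) ** S1 ** transpose K ** transpose L)"
      by (simp add: trace_mul_sym[of "transpose L"])
    also have "\<dots> = trace (?M ** S1 ** (transpose K ** transpose L))"
      by (simp add: 2 matrix_mul_assoc)
    finally show ?thesis by (simp add: tLK)
  qed
  have q2: "x \<bullet> (matrix_inv S2 *v x) = (K *v x) \<bullet> (K *v x)" for x
    by (simp only: inv2 inner_transpose_mult)
  \<comment> \<open>Inserting \<open>x = L *v (K *v x)\<close> on both sides of \<open>?M\<close>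
    produces \<open>B\<close>.\<close>
  have q3: "x \<bullet> (?M *v x) = (K *v x) \<bullet> (B *v (K *v x))" for x
  proof -
    have "x = L *v (K *v x)" by (simp add: matrix_vector_mul_assoc 2)
    then have "x \<bullet> (?M *v x) = (L *v (K *v x)) \<bullet> (?M *v (L *v (K *v x)))" by simp
    also have "\<dots> = (K *v x) \<bullet> (B *v (K *v x))"
      by (simp only: B_def matrix_mul_assoc[symmetric] inner_transpose_mult matrix_vector_mul_assoc)
    finally show ?thesis .
  qed
  have mm: "m + m' = K *v (mu1 - mu3)"
    by (simp add: m_def m'_def flip: matrix_vector_right_distrib)
  define a where "a = lambertWm1 (- exp (- (1 + 2 * eps1)))"
  define b where "b = lambertWm1 (- exp (- (1 + 2 * eps2)))"
  define c where "c = lambertW0 (- exp (- (1 + 2 * eps2)))"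
  have KL12: "2 * KL_div (gauss_density mu1 S1) (gauss_density mu2 S2) =
      trace A - ln (det A) - real CARD('n) + m \<bullet> m"
    by (simp add: KL_div_gauss assms trA lnA q2 m_def)
  have KL23: "2 * KL_div (gauss_density mu2 S2) (gauss_density mu3 S3) =
      trace B - ln (det B) - real CARD('n) + m' \<bullet> (B *v m')"
    by (simp add: KL_div_gauss assms trB lnB q3 m'_def)
  have KL13: "2 * KL_div (gauss_density mu1 S1) (gauss_density mu3 S3) =
      trace (B ** A) - ln (det A) - ln (det B) - real CARD('n) + (m + m') \<bullet> (B *v (m + m'))"
    by (simp add: KL_div_gauss assms trBA lnA lnB q3 mm)
  \<comment> \<open>The whitened bound at budgets \<open>2 * eps1\<close> and
    \<open>2 * eps2\<close>. The negated Lambert values solve the equations required of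
    \<open>\<alpha>\<close>, \<open>\<beta>\<close> and \<open>\<gamma>\<close>.\<close>
  have "2 * KL_div (gauss_density mu1 S1) (gauss_density mu3 S3) <
      2 * eps1 + 2 * eps2 + (- a - 1) * (- b - 1)
        + - b * (sqrt (2 * eps1) + sqrt (2 * eps2 / - c))\<^sup>2"
    unfolding KL13
    using assms KL12 KL23 lambertWm1_itakura_saito[of "2 * eps1"] lambertWm1_itakura_saito[of "2 * eps2"]
      lambertW0_itakura_saito[of "2 * eps2"]
    by (intro relative_divergence_bound posA posB) (auto simp: a_def b_def c_def)
  also have "2 * eps1 + 2 * eps2 + (- a - 1) * (- b - 1) + - b * x
      = 2 * (eps1 + eps2 + (a * b + a + b + 1 - b * x) / 2)" for x
    by (simp add: field_simps)
  finally show ?thesis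
    unfolding Let_def a_def[symmetric] b_def[symmetric] c_def[symmetric]
    by (simp only: mult_less_cancel_left_pos zero_less_numeral)
qed


end
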